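(* Let $W$ be a connected, almost everywhere continuous graphon with degree function $k(x)=\int_0^1 W(x,y)\,dy$, and assume there is a constant $c$ with $0<c\le k(x)$ for all $x\in[0,1]$. Let $g\in L^2[0,1]$, and let $w(x,t)$ be the solution of the initial-value problem $$\frac{\partial}{\partial t}w(x,t)=\int_0^1\frac{W(x,y)}{k(y)}w(y,t)\,dy-w(x,t),\qquad w(x,0)=g(x).$$ For $n$ sufficiently large, let $u(x,t)=u^{(n)}(x,t)$ be the solution of the associated discrete problem (in step-function form) on the sampled graph $W_{[n]}$, $$\frac{\partial}{\partial t}u(x,t)=\int_0^1\frac{\eta(W_{[n]})(x,y)}{k_{[n]}(y)}u(y,t)\,dy-u(x,t),\qquad u(x,0)=g_\square(x).$$ Then for all $t\in\mathbb R^+$, $$\|u(\cdot,t)-w(\cdot,t)\|_{2}\to 0\quad\text{as } n\to\infty .$$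
   Context: A graphon is a symmetric Lebesgue-measurable function $W:[0,1]^2\to[0,1]$. It is connected if $\int_{S\times([0,1]\setminus S)}W(x,y)\,dx\,dy>0$ for every Lebesgue-measurable $S\subset[0,1]$ with Lebesgue measure $\mu(S)\in(0,1)$. Almost everywhere continuous means that the set of points of $[0,1]^2$ at which $W$ is discontinuous has Lebesgue measure zero. Uniform partition: for $n\ge1$, $\mathcal P=\{P_1,\dots,P_n\}$ with $P_i=[\frac{i-1}{n},\frac in)$ for $i=1,\dots,n-1$ and $P_n=[\frac{n-1}{n},1]$. Sampled graph $W_{[n]}$: the weighted graph on $n$ nodes with edge weights $A_{ij}=W\left(\frac in,\frac jn\right)$, $i,j=1,\dots,n$. Its step graphon is $\eta(W_{[n]})(x,y)=\sum_{i,j=1}^n A_{ij}\chi_{P_i}(x)\chi_{P_j}(y)$, where $\chi_S$ is the indicator function of $S$, and $k_{[n]}(x)=\int_0^1\eta(W_{[n]})(x,y)\,dy$ is its degree function. The averaged initial condition is $g_\square(x)=n\sum_{i=1}^n\left(\int_{P_i}g(y)\,dy\right)\chi_{P_i}(x)$. The number of nodes $n$ is taken sufficiently large, which is understood to guarantee that $k_{[n]}$ is bounded away from $0$, so that the operator in the discrete problem is well-defined on $L^2[0,1]$. Solutions are classical solutions of the abstract Cauchy problem in $L^2[0,1]$, i.e. $t\mapsto w(\cdot,t)\in L^2[0,1]$ is continuously differentiable and satisfies the equation and initial condition. $\|\cdot\|_2$ is the $L^2[0,1]$ norm.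
   Formalization: It is assumed explicitly that the degree functions k_[n] are bounded below by one positive constant for all sufficiently large n; this does not follow from the other hypotheses, and the claim can fail if the lower bound on k_[n] may depend on n. *)

theory Defs
  imports "HOL-Analysis.Analysis"
begin

text \<open>
  Functions on the unit square are functions on pairs of reals, only their values on the unit
  square being relevant. Elements of the real Hilbert space \<open>L\<^sup>2[0,1]\<close> are
  represented by square-integrable functions; equality in \<open>L\<^sup>2[0,1]\<close> is equality
  almost everywhere.
\<close>

abbreviation unit_measure :: "real measure" where
  "unit_measure \<equiv> lebesgue_on {0..1}"

definition L2 :: "(real \<Rightarrow> real) set" where
  "L2 = {f \<in> borel_measurable unit_measure. integrable unit_measure (\<lambda>x. (f x)\<^sup>2)}"

definition L2norm :: "(real \<Rightarrow> real) \<Rightarrow> real" where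
  "L2norm f = sqrt (LINT x|unit_measure. (f x)\<^sup>2)"

definition graphon :: "(real \<times> real \<Rightarrow> real) \<Rightarrow> bool" where
  "graphon W \<longleftrightarrow>
     W \<in> borel_measurable (lebesgue_on ({0..1} \<times> {0..1})) \<and>
     (\<forall>x\<in>{0..1}. \<forall>y\<in>{0..1}. 0 \<le> W (x, y) \<and> W (x, y) \<le> 1 \<and> W (x, y) = W (y, x))"

definition connected_graphon :: "(real \<times> real \<Rightarrow> real) \<Rightarrow> bool" where
  "connected_graphon W \<longleftrightarrow>
     (\<forall>S. S \<subseteq> {0..1} \<and> S \<in> sets lebesgue \<and> 0 < measure lebesgue S \<and> measure lebesgue S < 1 \<longrightarrow>
        0 < (LINT p|lebesgue_on (S \<times> ({0..1} - S)). W p))"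

definition ae_continuous :: "(real \<times> real \<Rightarrow> real) \<Rightarrow> bool" where
  "ae_continuous W \<longleftrightarrow>
     {p \<in> {0..1} \<times> {0..1}. \<not> continuous (at p within {0..1} \<times> {0..1}) W} \<in> null_sets lebesgue"

text \<open>
  The integral of a function that is not integrable is \<open>0\<close>, so a positive lower bound on
  \<open>graphon_degree W x\<close> entails that the section of \<open>W\<close> at \<open>x\<close> is
  integrable.
\<close>

definition graphon_degree :: "(real \<times> real \<Rightarrow> real) \<Rightarrow> real \<Rightarrow> real" where
  "graphon_degree W x = (LINT y|unit_measure. W (x, y))"

definition uniform_part :: "nat \<Rightarrow> nat \<Rightarrow> real set" where
  "uniform_part n i =
     (if i = n then {(real n - 1) / real n..1} else {(real i - 1) / real n..<real i / real n})"

definition sampled_graph :: "(real \<times> real \<Rightarrow> real) \<Rightarrow> nat \<Rightarrow> nat \<Rightarrow> nat \<Rightarrow> real" where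
  "sampled_graph W n i j = W (real i / real n, real j / real n)"

definition step_graphon :: "nat \<Rightarrow> (nat \<Rightarrow> nat \<Rightarrow> real) \<Rightarrow> real \<times> real \<Rightarrow> real" where
  "step_graphon n A = (\<lambda>(x, y). \<Sum>i=1..n. \<Sum>j=1..n.
     A i j * indicator (uniform_part n i) x * indicator (uniform_part n j) y)"

definition averaged :: "nat \<Rightarrow> (real \<Rightarrow> real) \<Rightarrow> real \<Rightarrow> real" where
  "averaged n g x =
     real n * (\<Sum>i=1..n. (LINT y|lebesgue_on (uniform_part n i). g y) * indicator (uniform_part n i) x)"

definition walk_generator :: "(real \<times> real \<Rightarrow> real) \<Rightarrow> (real \<Rightarrow> real) \<Rightarrow> real \<Rightarrow> real" where
  "walk_generator W f x = (LINT y|unit_measure. W (x, y) / graphon_degree W y * f y) - f x"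

text \<open>
  Calculus of curves \<open>[0,\<infinity>) \<rightarrow> L\<^sup>2[0,1]\<close>. A curve
  \<open>v\<close> has value \<open>v t\<close> (a function of the space variable) at time
  \<open>t\<close>; limits at time \<open>0\<close> are one-sided.
\<close>

definition L2_continuous :: "(real \<Rightarrow> real \<Rightarrow> real) \<Rightarrow> bool" where
  "L2_continuous v \<longleftrightarrow> (\<forall>t\<ge>0. v t \<in> L2) \<and>
     (\<forall>t\<ge>0. ((\<lambda>s. L2norm (\<lambda>x. v s x - v t x)) \<longlongrightarrow> 0) (at t within {0..}))"

definition L2_has_derivative :: "(real \<Rightarrow> real \<Rightarrow> real) \<Rightarrow> (real \<Rightarrow> real \<Rightarrow> real) \<Rightarrow> bool" where
  "L2_has_derivative v v' \<longleftrightarrow> (\<forall>t\<ge>0. v t \<in> L2 \<and> v' t \<in> L2) \<and>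
     (\<forall>t\<ge>0. ((\<lambda>s. L2norm (\<lambda>x. (v s x - v t x) / (s - t) - v' t x)) \<longlongrightarrow> 0) (at t within {0..}))"

definition classical_solution ::
  "(real \<times> real \<Rightarrow> real) \<Rightarrow> (real \<Rightarrow> real) \<Rightarrow> (real \<Rightarrow> real \<Rightarrow> real) \<Rightarrow> bool" where
  "classical_solution W g w \<longleftrightarrow>
     (\<exists>w'. L2_has_derivative w w' \<and> L2_continuous w' \<and>
        (\<forall>t\<ge>0. AE x in unit_measure. w' t x = walk_generator W (w t) x)) \<and>
     (AE x in unit_measure. w 0 x = g x)"

end

theory Submission
  imports Defs
begin

text \<open>
  Write \<open>K(x, y) = W(x, y) / k(y)\<close> and \<open>K\<^sub>n\<close> for the same expression formed from the
  sampled step graphon. Both evolution equations have the form \<open>v' = T v - v\<close>, where \<open>T\<close> is the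
  integral operator with kernel \<open>K\<close> or \<open>K\<^sub>n\<close>. The theorem is continuous dependence of the flow on
  the kernel, measured in the Hilbert-Schmidt norm, and on the initial value.

  The difference \<open>v = u - w\<close> satisfies \<open>v' = T\<^sub>n v - v + (T\<^sub>n - T) w\<close>. Pairing with \<open>v\<close>
  gives a differential inequality for \<open>\<parallel>v\<parallel>\<^sup>2\<close>, and Gronwall's argument
  (\<open>L2_energy_estimate\<close>) turns it into a bound on \<open>\<parallel>v(t)\<parallel>\<^sup>2\<close> in terms of
  \<open>\<parallel>v(0)\<parallel>\<close>, of \<open>\<parallel>K\<^sub>n - K\<parallel>\<close> in the Hilbert-Schmidt norm, and of the supremum of
  \<open>\<parallel>w\<parallel>\<close> on \<open>[0, t]\<close> (\<open>kernel_flow_perturbation\<close>). Two quantities must therefore vanish in the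
  limit.

  The kernels: at every continuity point of \<open>W\<close> the step graphons converge to \<open>W\<close>, because the
  sampling point of the cell of \<open>(x, y)\<close> is within distance \<open>1 / n\<close> of \<open>(x, y)\<close> in each
  coordinate. Fubini turns almost everywhere convergence on the square into convergence on almost every
  section; dominated convergence on the sections gives convergence of the degrees, hence of
  \<open>K\<^sub>n\<close> to \<open>K\<close> (\<open>AE_sampled_walk_kernel_tendsto\<close>). The lower bound on the degrees of the samples
  bounds the \<open>K\<^sub>n\<close> uniformly, so dominated convergence upgrades this to the Hilbert-Schmidt norm
  (\<open>HS_norm_limit\<close>).

  The initial values: averaging over the partition is a contraction of \<open>L\<^sup>2[0,1]\<close> and converges
  on bounded continuous functions, which are dense, so it converges on all of \<open>L\<^sup>2[0,1]\<close>
  (\<open>averaged_tendsto\<close>).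
\<close>

section \<open>The space \<open>L\<^sup>2[0,1]\<close>\<close>

definition L2_inner :: "(real \<Rightarrow> real) \<Rightarrow> (real \<Rightarrow> real) \<Rightarrow> real" where
  "L2_inner f g = (LINT x|unit_measure. f x * g x)"

lemma finite_unit_measure: "finite_measure unit_measure"
  by (rule finite_measure_lebesgue_on) simp

lemma measure_unit_measure [simp]: "measure unit_measure {0..1} = 1"
  by (simp add: measure_restrict_space)

lemma sigma_finite_unit_measure: "sigma_finite_measure unit_measure"
  using finite_unit_measure by (rule finite_measure.axioms)

text \<open>
  Completeness of Lebesgue measure. The sections of the walk kernel of \<open>W\<close> agree almost everywhere
  with the sections of a measurable kernel; by this lemma they are measurable themselves, so that the
  integrals can be compared.
\<close>
lemma unit_measurable_AE:
  fixes f g :: "real \<Rightarrow> real"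
  assumes "f \<in> borel_measurable unit_measure" and "AE x in unit_measure. f x = g x"
  shows "g \<in> borel_measurable unit_measure"
proof -
  have iff: "k \<in> borel_measurable unit_measure
      \<longleftrightarrow> (\<lambda>x. indicator {0..1} x *\<^sub>R k x) \<in> borel_measurable lebesgue" for k :: "real \<Rightarrow> real"
    by (rule borel_measurable_restrict_space_iff) simp
  have "AE x in lebesgue. x \<in> {0..1} \<longrightarrow> f x = g x"
    using assms(2) by (simp add: AE_restrict_space_iff)
  then have "AE x in lebesgue. indicator {0..1} x *\<^sub>R f x = indicator {0..1} x *\<^sub>R g x"
    by eventually_elim (simp add: indicator_def)
  from borel_measurable_AE[OF _ this] show ?thesis
    using assms(1) unfolding iff .
qed

lemma integrable_unit_measure_bounded:
  fixes f :: "real \<Rightarrow> real"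
  assumes "f \<in> borel_measurable unit_measure" and "\<And>x. x \<in> {0..1} \<Longrightarrow> \<bar>f x\<bar> \<le> B"
  shows "integrable unit_measure f"
  using finite_measure.integrable_const_bound[OF finite_unit_measure _ assms(1), of B] assms(2)
  by (simp add: AE_restrict_space_iff)

lemma L2_measurable: "f \<in> L2 \<Longrightarrow> f \<in> borel_measurable unit_measure"
  by (simp add: L2_def)

lemma L2_integrable_square: "f \<in> L2 \<Longrightarrow> integrable unit_measure (\<lambda>x. (f x)\<^sup>2)"
  by (simp add: L2_def)

lemma L2_integrable_mult:
  assumes "f \<in> L2" and "g \<in> L2"
  shows "integrable unit_measure (\<lambda>x. f x * g x)"
proof (rule Bochner_Integration.integrable_bound)
  show "integrable unit_measure (\<lambda>x. (f x)\<^sup>2 + (g x)\<^sup>2)"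
    using assms by (simp add: L2_integrable_square)
  show "(\<lambda>x. f x * g x) \<in> borel_measurable unit_measure"
    using assms[THEN L2_measurable] by simp
  have "\<bar>f x * g x\<bar> \<le> (f x)\<^sup>2 + (g x)\<^sup>2" for x
  proof -
    have "2 * \<bar>f x * g x\<bar> \<le> (f x)\<^sup>2 + (g x)\<^sup>2"
      using sum_squares_bound[of "\<bar>f x\<bar>" "\<bar>g x\<bar>"] by (simp add: abs_mult mult.assoc)
    then show ?thesis by linarith
  qed
  then show "AE x in unit_measure. norm (f x * g x) \<le> norm ((f x)\<^sup>2 + (g x)\<^sup>2)"
    by simp
qed

lemma L2_scale:
  assumes "f \<in> L2" shows "(\<lambda>x. a * f x) \<in> L2"
  using assms by (auto simp: L2_def power_mult_distrib)

lemma L2_add: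
  assumes "f \<in> L2" and "g \<in> L2"
  shows "(\<lambda>x. f x + g x) \<in> L2"
  using assms[THEN L2_measurable] assms[THEN L2_integrable_square] L2_integrable_mult[OF assms]
  by (simp add: L2_def power2_sum mult.assoc)

lemma L2_diff:
  assumes "f \<in> L2" and "g \<in> L2"
  shows "(\<lambda>x. f x - g x) \<in> L2"
  using L2_add[OF assms(1) L2_scale[OF assms(2), of "-1"]] by simp

lemma L2_bounded:
  fixes f :: "real \<Rightarrow> real"
  assumes "f \<in> borel_measurable unit_measure" and "\<And>x. x \<in> {0..1} \<Longrightarrow> \<bar>f x\<bar> \<le> B"
  shows "f \<in> L2"
proof -
  have "\<bar>(f x)\<^sup>2\<bar> \<le> B\<^sup>2" if "x \<in> {0..1}" for x
    using power_mono[OF assms(2)[OF that] abs_ge_zero, of 2] by simp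
  then show ?thesis
    using assms by (auto simp: L2_def intro!: integrable_unit_measure_bounded[where B = "B\<^sup>2"])
qed

lemma L2_sum:
  assumes "\<And>i. i \<in> I \<Longrightarrow> f i \<in> L2"
  shows "(\<lambda>x. \<Sum>i\<in>I. f i x) \<in> L2"
  using assms
proof (induction I rule: infinite_finite_induct)
  case (insert i I)
  then show ?case
    using L2_add[of "f i" "\<lambda>x. \<Sum>i\<in>I. f i x"] by simp
qed (auto intro: L2_bounded[of _ 0])

lemma L2_integrable:
  assumes "f \<in> L2" shows "integrable unit_measure f"
  using L2_integrable_mult[OF assms, of "\<lambda>_. 1"] L2_bounded[of "\<lambda>_. 1" 1] by simp

lemma L2norm_nonneg [simp]: "0 \<le> L2norm f"
  by (simp add: L2norm_def)

lemma L2norm_power2: "(L2norm f)\<^sup>2 = (LINT x|unit_measure. (f x)\<^sup>2)"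
  by (simp add: L2norm_def)

lemma L2norm_power2_inner: "(L2norm f)\<^sup>2 = L2_inner f f"
  unfolding L2norm_power2 L2_inner_def by (simp only: power2_eq_square)

lemma L2norm_scale: "L2norm (\<lambda>x. a * f x) = \<bar>a\<bar> * L2norm f"
  by (simp add: L2norm_def power_mult_distrib real_sqrt_mult)

lemma L2norm_cong_AE:
  assumes "f \<in> L2" and "g \<in> L2" and "AE x in unit_measure. f x = g x"
  shows "L2norm f = L2norm g"
  unfolding L2norm_def
  using assms by (intro arg_cong[where f = sqrt] integral_cong_AE) (auto dest: L2_measurable)

lemma L2_inner_commute: "L2_inner f g = L2_inner g f"
  by (simp add: L2_inner_def mult.commute)

lemma L2_inner_add_right:
  assumes "f \<in> L2" and "g \<in> L2" and "h \<in> L2"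
  shows "L2_inner f (\<lambda>x. g x + h x) = L2_inner f g + L2_inner f h"
  using assms by (simp add: L2_inner_def distrib_left L2_integrable_mult)

lemma L2_inner_diff_right:
  assumes "f \<in> L2" and "g \<in> L2" and "h \<in> L2"
  shows "L2_inner f (\<lambda>x. g x - h x) = L2_inner f g - L2_inner f h"
  using assms by (simp add: L2_inner_def right_diff_distrib L2_integrable_mult)

lemma L2_inner_scale_right: "L2_inner f (\<lambda>x. a * g x) = a * L2_inner f g"
  by (simp add: L2_inner_def mult.left_commute)

lemma L2_inner_sum_right:
  assumes "f \<in> L2" and "\<And>i. i \<in> I \<Longrightarrow> g i \<in> L2"
  shows "L2_inner f (\<lambda>x. \<Sum>i\<in>I. g i x) = (\<Sum>i\<in>I. L2_inner f (g i))"
  unfolding L2_inner_def sum_distrib_left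
  using assms by (intro Bochner_Integration.integral_sum L2_integrable_mult) auto

lemma L2_inner_cong_AE:
  assumes "f \<in> L2" and "g \<in> L2" and "h \<in> L2" and "AE x in unit_measure. g x = h x"
  shows "L2_inner f g = L2_inner f h"
  unfolding L2_inner_def
  using assms(4) assms(1-3)[THEN L2_measurable] by (intro integral_cong_AE) auto

lemma L2norm_add_power2:
  assumes "f \<in> L2" and "g \<in> L2"
  shows "(L2norm (\<lambda>x. f x + g x))\<^sup>2 = (L2norm f)\<^sup>2 + 2 * L2_inner f g + (L2norm g)\<^sup>2"
  using assms L2_integrable_mult[OF assms] assms[THEN L2_integrable_square]
  by (simp add: L2norm_power2 L2_inner_def power2_sum mult.assoc)

text \<open>
  The quadratic polynomial \<open>a \<mapsto> \<parallel>f + a g\<parallel>\<^sup>2\<close> is nonnegative, so its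
  discriminant is not positive.
\<close>
lemma L2_Cauchy_Schwarz:
  assumes "f \<in> L2" and "g \<in> L2"
  shows "\<bar>L2_inner f g\<bar> \<le> L2norm f * L2norm g"
proof -
  have nonneg: "0 \<le> (L2norm f)\<^sup>2 + 2 * a * L2_inner f g + a\<^sup>2 * (L2norm g)\<^sup>2" for a
  proof -
    have "(L2norm (\<lambda>x. f x + a * g x))\<^sup>2 = (L2norm f)\<^sup>2 + 2 * a * L2_inner f g + a\<^sup>2 * (L2norm g)\<^sup>2"
      using L2norm_add_power2[OF assms(1) L2_scale[OF assms(2), of a]]
      by (simp add: L2_inner_scale_right L2norm_scale power_mult_distrib)
    then show ?thesis
      using zero_le_power2[of "L2norm (\<lambda>x. f x + a * g x)"] by linarith
  qed
  have "(L2_inner f g)\<^sup>2 \<le> (L2norm f)\<^sup>2 * (L2norm g)\<^sup>2"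
  proof (cases "L2norm g = 0")
    case True
    have "L2_inner f g = 0"
    proof (rule ccontr)
      assume ne: "L2_inner f g \<noteq> 0"
      show False
        \<comment> \<open>For \<open>g\<close> of norm \<open>0\<close> the polynomial is affine; here its value is \<open>-1\<close>.\<close>
        using nonneg[of "- (((L2norm f)\<^sup>2 + 1) / (2 * L2_inner f g))"] True ne by simp
    qed
    then show ?thesis by simp
  next
    case False
    \<comment> \<open>The polynomial is minimal at \<open>a = - \<langle>f, g\<rangle> / N\<close>.\<close>
    define N where "N = (L2norm g)\<^sup>2"
    have N: "0 < N"
      using False by (simp add: N_def)
    have "2 * (- L2_inner f g / N) * L2_inner f g + (- L2_inner f g / N)\<^sup>2 * N = - (L2_inner f g)\<^sup>2 / N"
      using N by (simp add: power2_eq_square divide_simps)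
    then have "(L2_inner f g)\<^sup>2 / N \<le> (L2norm f)\<^sup>2"
      using nonneg[of "- L2_inner f g / N"] by (simp add: N_def)
    then show ?thesis
      using N by (simp add: divide_le_eq N_def)
  qed
  then have "\<bar>L2_inner f g\<bar>\<^sup>2 \<le> (L2norm f * L2norm g)\<^sup>2"
    by (simp add: power_mult_distrib)
  then show ?thesis
    by (rule power2_le_imp_le) simp
qed

lemma L2norm_triangle:
  assumes "f \<in> L2" and "g \<in> L2"
  shows "L2norm (\<lambda>x. f x + g x) \<le> L2norm f + L2norm g"
proof (rule power2_le_imp_le)
  show "(L2norm (\<lambda>x. f x + g x))\<^sup>2 \<le> (L2norm f + L2norm g)\<^sup>2"
    using L2_Cauchy_Schwarz[OF assms] by (simp add: L2norm_add_power2[OF assms] power2_sum)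
qed simp

lemma L2norm_triangle_diff:
  assumes "f \<in> L2" and "g \<in> L2"
  shows "L2norm (\<lambda>x. f x - g x) \<le> L2norm f + L2norm g"
  using L2norm_triangle[OF assms(1) L2_scale[OF assms(2), of "-1"]] L2norm_scale[of "-1" g] by simp

lemma L2norm_mono:
  assumes "f \<in> L2" and "g \<in> L2" and "\<And>x. x \<in> {0..1} \<Longrightarrow> \<bar>f x\<bar> \<le> \<bar>g x\<bar>"
  shows "L2norm f \<le> L2norm g"
  unfolding L2norm_def
  using assms by (intro real_sqrt_le_mono integral_mono) (auto simp: L2_integrable_square abs_le_square_iff)

lemma L2norm_le_bounded:
  fixes f :: "real \<Rightarrow> real"
  assumes "f \<in> borel_measurable unit_measure" and "\<And>x. x \<in> {0..1} \<Longrightarrow> \<bar>f x\<bar> \<le> B"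
    and "0 \<le> B"
  shows "L2norm f \<le> B"
proof (rule power2_le_imp_le)
  have sq: "(f x)\<^sup>2 \<le> B\<^sup>2" if "x \<in> {0..1}" for x
    using power_mono[OF assms(2)[OF that] abs_ge_zero, of 2] by simp
  have "(LINT x|unit_measure. (f x)\<^sup>2) \<le> (LINT x|unit_measure. B\<^sup>2)"
    using sq finite_measure.integrable_const[OF finite_unit_measure] L2_bounded[OF assms(1,2)]
    by (intro integral_mono) (auto simp: L2_integrable_square)
  then show "(L2norm f)\<^sup>2 \<le> B\<^sup>2"
    by (simp add: L2norm_power2)
qed (use assms in simp)

lemma L2norm_dominated_convergence:
  assumes "\<And>n. f n \<in> borel_measurable unit_measure" and "h \<in> L2"
    and "\<And>n x. x \<in> {0..1} \<Longrightarrow> \<bar>f n x\<bar> \<le> \<bar>h x\<bar>"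
    and "AE x in unit_measure. (\<lambda>n. f n x) \<longlonglongrightarrow> 0"
  shows "(\<lambda>n. L2norm (f n)) \<longlonglongrightarrow> 0"
proof -
  have "(\<lambda>n. LINT x|unit_measure. (f n x)\<^sup>2) \<longlonglongrightarrow> (LINT x|unit_measure. 0)"
  proof (rule integral_dominated_convergence[where w = "\<lambda>x. (h x)\<^sup>2"])
    show "AE x in unit_measure. (\<lambda>n. (f n x)\<^sup>2) \<longlonglongrightarrow> 0"
      using assms(4) by eventually_elim (auto intro: tendsto_eq_intros)
    show "AE x in unit_measure. norm ((f n x)\<^sup>2) \<le> (h x)\<^sup>2" for n
      using assms(3) by (intro AE_I2) (simp add: abs_le_square_iff)
    show "integrable unit_measure (\<lambda>x. (h x)\<^sup>2)"
      by (rule L2_integrable_square[OF assms(2)])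
  qed (use assms(1) in simp_all)
  then show ?thesis
    unfolding L2norm_def by (auto intro: tendsto_eq_intros)
qed

corollary L2norm_bounded_convergence:
  assumes "\<And>n. f n \<in> borel_measurable unit_measure"
    and "\<And>n x. x \<in> {0..1} \<Longrightarrow> \<bar>f n x\<bar> \<le> B"
    and "AE x in unit_measure. (\<lambda>n. f n x) \<longlonglongrightarrow> 0"
  shows "(\<lambda>n. L2norm (f n)) \<longlonglongrightarrow> 0"
proof (rule L2norm_dominated_convergence[OF assms(1) _ _ assms(3), where h = "\<lambda>_. B"])
  show "\<bar>f n x\<bar> \<le> \<bar>B\<bar>" if "x \<in> {0..1}" for n x
    using assms(2)[OF that, of n] by linarith
qed (auto intro: L2_bounded[of _ "\<bar>B\<bar>"])

section \<open>Differentiable curves in \<open>L\<^sup>2[0,1]\<close>\<close>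

lemma L2_has_derivative_diff:
  assumes "L2_has_derivative v v'" and "L2_has_derivative w w'"
  shows "L2_has_derivative (\<lambda>t x. v t x - w t x) (\<lambda>t x. v' t x - w' t x)"
  unfolding L2_has_derivative_def
proof (intro conjI allI impI)
  fix t :: real assume "0 \<le> t"
  note vt = assms(1)[unfolded L2_has_derivative_def, THEN conjunct1, rule_format]
  note wt = assms(2)[unfolded L2_has_derivative_def, THEN conjunct1, rule_format]
  show "(\<lambda>x. v t x - w t x) \<in> L2" "(\<lambda>x. v' t x - w' t x) \<in> L2"
    using vt wt \<open>0 \<le> t\<close> by (auto intro: L2_diff)
  let ?q = "\<lambda>v v' s x. (v s x - v t x) / (s - t) - v' t x"
  have q_L2: "?q v v' s \<in> L2" if "0 \<le> s" and "\<And>r. 0 \<le> r \<Longrightarrow> v r \<in> L2 \<and> v' r \<in> L2" for s v v'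
    using L2_diff[OF L2_scale[of "\<lambda>x. v s x - v t x" "1 / (s - t)"], of "v' t"] L2_diff that \<open>0 \<le> t\<close>
    by simp
  show "((\<lambda>s. L2norm (\<lambda>x. (v s x - w s x - (v t x - w t x)) / (s - t) - (v' t x - w' t x)))
      \<longlongrightarrow> 0) (at t within {0..})"
  proof (rule Lim_null_comparison)
    show "((\<lambda>s. L2norm (?q v v' s) + L2norm (?q w w' s)) \<longlongrightarrow> 0) (at t within {0..})"
      using assms \<open>0 \<le> t\<close> unfolding L2_has_derivative_def by (intro tendsto_add_zero) auto
    have "L2norm (\<lambda>x. (v s x - w s x - (v t x - w t x)) / (s - t) - (v' t x - w' t x))
        \<le> L2norm (?q v v' s) + L2norm (?q w w' s)" if "0 \<le> s" for s
    proof -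
      have "(\<lambda>x. (v s x - w s x - (v t x - w t x)) / (s - t) - (v' t x - w' t x))
          = (\<lambda>x. ?q v v' s x - ?q w w' s x)"
        by (intro ext) (simp add: diff_divide_distrib)
      then show ?thesis
        using L2norm_triangle_diff[OF q_L2[OF that vt] q_L2[OF that wt]] by simp
    qed
    then show "\<forall>\<^sub>F s in at t within {0..}.
        norm (L2norm (\<lambda>x. (v s x - w s x - (v t x - w t x)) / (s - t) - (v' t x - w' t x)))
        \<le> L2norm (?q v v' s) + L2norm (?q w w' s)"
      by (auto simp: eventually_at_filter)
  qed
qed

text \<open>
  With the difference quotient \<open>q = (v s - v t) / (s - t)\<close> one has
  \<open>(\<parallel>v s\<parallel>\<^sup>2 - \<parallel>v t\<parallel>\<^sup>2) / (s - t) = 2 \<langle>v t, q\<rangle> + (s - t) \<parallel>q\<parallel>\<^sup>2\<close>. Since \<open>q\<close>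
  converges to \<open>v' t\<close>, its norm stays bounded and the last term vanishes in the limit.
\<close>
lemma L2norm_power2_has_derivative:
  assumes "L2_has_derivative v v'" and "0 \<le> t"
  shows "((\<lambda>s. (L2norm (v s))\<^sup>2) has_real_derivative 2 * L2_inner (v t) (v' t)) (at t within {0..})"
proof -
  note vL2 = assms(1)[unfolded L2_has_derivative_def, THEN conjunct1, rule_format]
  define q where "q s x = (v s x - v t x) / (s - t)" for s x
  define e where "e s = L2norm (\<lambda>x. q s x - v' t x)" for s
  have q: "q s \<in> L2" if "0 \<le> s" for s
    using L2_scale[OF L2_diff, of "v s" "v t" "1 / (s - t)"] vL2 that \<open>0 \<le> t\<close>
    by (simp add: q_def[abs_def])
  have e: "(e \<longlongrightarrow> 0) (at t within {0..})"
    using assms unfolding L2_has_derivative_def e_def[abs_def] q_def by auto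
  define bound where
    "bound s = 2 * (L2norm (v t) * e s) + \<bar>s - t\<bar> * (L2norm (v' t) + e s)\<^sup>2" for s
  have estimate: "\<bar>((L2norm (v s))\<^sup>2 - (L2norm (v t))\<^sup>2) / (s - t) - 2 * L2_inner (v t) (v' t)\<bar> \<le> bound s"
    if "0 \<le> s" "s \<noteq> t" for s
  proof -
    have vs: "v s = (\<lambda>x. v t x + (s - t) * q s x)"
      using that by (auto simp: q_def)
    have "(L2norm (v s))\<^sup>2 = (L2norm (v t))\<^sup>2 + 2 * ((s - t) * L2_inner (v t) (q s))
        + (s - t)\<^sup>2 * (L2norm (q s))\<^sup>2"
      unfolding vs using vL2[OF \<open>0 \<le> t\<close>] q[OF \<open>0 \<le> s\<close>]
      by (simp add: L2norm_add_power2 L2_scale L2_inner_scale_right L2norm_scale power_mult_distrib)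
    then have "((L2norm (v s))\<^sup>2 - (L2norm (v t))\<^sup>2) / (s - t)
        = 2 * L2_inner (v t) (q s) + (s - t) * (L2norm (q s))\<^sup>2"
      using that by (simp add: add_divide_distrib power2_eq_square)
    then have "((L2norm (v s))\<^sup>2 - (L2norm (v t))\<^sup>2) / (s - t) - 2 * L2_inner (v t) (v' t)
        = 2 * L2_inner (v t) (\<lambda>x. q s x - v' t x) + (s - t) * (L2norm (q s))\<^sup>2"
      using vL2[OF \<open>0 \<le> t\<close>] q[OF \<open>0 \<le> s\<close>] by (simp add: L2_inner_diff_right)
    moreover have "\<bar>L2_inner (v t) (\<lambda>x. q s x - v' t x)\<bar> \<le> L2norm (v t) * e s"
      unfolding e_def using vL2[OF \<open>0 \<le> t\<close>] q[OF \<open>0 \<le> s\<close>]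
      by (intro L2_Cauchy_Schwarz L2_diff) auto
    moreover have "L2norm (q s) \<le> L2norm (v' t) + e s"
      unfolding e_def
      using L2norm_triangle[of "v' t" "\<lambda>x. q s x - v' t x"] vL2[OF \<open>0 \<le> t\<close>] q[OF \<open>0 \<le> s\<close>]
      by (simp add: L2_diff)
    then have "\<bar>(s - t) * (L2norm (q s))\<^sup>2\<bar> \<le> \<bar>s - t\<bar> * (L2norm (v' t) + e s)\<^sup>2"
      by (simp add: abs_mult mult_left_mono power_mono)
    ultimately show ?thesis
      unfolding bound_def by linarith
  qed
  have "(bound \<longlongrightarrow> 2 * (L2norm (v t) * 0) + \<bar>t - t\<bar> * (L2norm (v' t) + 0)\<^sup>2) (at t within {0..})"
    unfolding bound_def[abs_def] by (intro tendsto_intros e)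
  then have "(bound \<longlongrightarrow> 0) (at t within {0..})"
    by simp
  then have "((\<lambda>s. ((L2norm (v s))\<^sup>2 - (L2norm (v t))\<^sup>2) / (s - t) - 2 * L2_inner (v t) (v' t)) \<longlongrightarrow> 0)
      (at t within {0..})"
    by (rule Lim_null_comparison[rotated]) (use estimate in \<open>auto simp: eventually_at_filter\<close>)
  then show ?thesis
    unfolding has_field_derivative_iff by (simp add: LIM_zero_iff)
qed

lemma L2norm_power2_continuous_on:
  assumes "L2_has_derivative v v'"
  shows "continuous_on {0..} (\<lambda>t. (L2norm (v t))\<^sup>2)"
  using L2norm_power2_has_derivative[OF assms]
  by (auto intro!: DERIV_continuous_on)

lemma L2_curve_bounded:
  assumes "L2_has_derivative w w'"
  obtains R where "\<forall>t\<in>{0..T}. L2norm (w t) \<le> R"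
proof -
  have "compact ((\<lambda>t. (L2norm (w t))\<^sup>2) ` {0..T})"
    using continuous_on_subset[OF L2norm_power2_continuous_on[OF assms], of "{0..T}"]
    by (intro compact_continuous_image) auto
  then have "bounded ((\<lambda>t. (L2norm (w t))\<^sup>2) ` {0..T})"
    by (rule compact_imp_bounded)
  then obtain S where S: "\<And>y. y \<in> (\<lambda>t. (L2norm (w t))\<^sup>2) ` {0..T} \<Longrightarrow> norm y \<le> S"
    unfolding bounded_iff by blast
  have "L2norm (w t) \<le> sqrt S" if "t \<in> {0..T}" for t
    using S[of "(L2norm (w t))\<^sup>2"] that by (intro real_le_rsqrt) auto
  then show thesis
    using that by blast
qed

text \<open>
  Gronwall's inequality in the form needed for energy estimates: by the assumption, the function
  \<open>exp (- A t) \<parallel>v t\<parallel>\<^sup>2 - B t\<close> does not increase on \<open>[0, T]\<close>.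
\<close>
lemma L2_energy_estimate:
  assumes deriv: "L2_has_derivative v v'" and "0 \<le> T" and "0 \<le> A" and "0 \<le> B"
    and energy: "\<And>t. 0 < t \<Longrightarrow> t < T \<Longrightarrow> 2 * L2_inner (v t) (v' t) \<le> A * (L2norm (v t))\<^sup>2 + B"
  shows "(L2norm (v T))\<^sup>2 \<le> exp (A * T) * ((L2norm (v 0))\<^sup>2 + B * T)"
proof (cases "T = 0")
  case False
  define \<psi> where "\<psi> t = exp (- A * t) * (L2norm (v t))\<^sup>2 - B * t" for t
  have deriv_\<psi>: "\<exists>y. (\<psi> has_real_derivative y) (at t) \<and> y \<le> 0" if t: "0 < t" "t < T" for t
  proof -
    have "((\<lambda>s. (L2norm (v s))\<^sup>2) has_real_derivative 2 * L2_inner (v t) (v' t)) (at t within {0..})"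
      using L2norm_power2_has_derivative[OF deriv] t by simp
    moreover have "at t within {0..} = at t"
      using t by (intro at_within_interior) simp
    ultimately have "((\<lambda>s. (L2norm (v s))\<^sup>2) has_real_derivative 2 * L2_inner (v t) (v' t)) (at t)"
      by simp
    from DERIV_mult[OF _ this, of "\<lambda>s. exp (- A * s)" "exp (- A * t) * (- A)"]
    have "(\<psi> has_real_derivative
        exp (- A * t) * (2 * L2_inner (v t) (v' t) - A * (L2norm (v t))\<^sup>2) - B) (at t)"
      unfolding \<psi>_def[abs_def]
      by (rule DERIV_cong[OF DERIV_diff]) (auto intro!: derivative_eq_intros simp: algebra_simps)
    moreover have "exp (- A * t) * (2 * L2_inner (v t) (v' t) - A * (L2norm (v t))\<^sup>2) \<le> exp (- A * t) * B"
      using energy[OF t] by (intro mult_left_mono) auto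
    moreover have "exp (- A * t) * B \<le> 1 * B"
      using t \<open>0 \<le> A\<close> \<open>0 \<le> B\<close> by (intro mult_right_mono) auto
    ultimately show ?thesis
      by (intro exI conjI) (assumption, linarith)
  qed
  have "0 < T"
    using False \<open>0 \<le> T\<close> by simp
  moreover have "continuous_on {0..T} \<psi>"
    unfolding \<psi>_def[abs_def]
    by (intro continuous_intros continuous_on_subset[OF L2norm_power2_continuous_on[OF deriv]]) auto
  moreover have "\<psi> differentiable (at t)" if "0 < t" "t < T" for t
    using deriv_\<psi>[OF that] real_differentiable_def by blast
  ultimately obtain y t where t: "0 < t" "t < T" "(\<psi> has_real_derivative y) (at t)"
    and "\<psi> T - \<psi> 0 = (T - 0) * y"
    using MVT[of 0 T \<psi>] by blast
  moreover have "y \<le> 0"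
    using deriv_\<psi>[OF t(1,2)] DERIV_unique[OF t(3)] by blast
  ultimately have "\<psi> T \<le> \<psi> 0"
    using \<open>0 < T\<close> mult_nonneg_nonpos[of T y] by simp
  then have "exp (- A * T) * (L2norm (v T))\<^sup>2 \<le> (L2norm (v 0))\<^sup>2 + B * T"
    by (simp add: \<psi>_def)
  then show ?thesis
    by (simp add: exp_minus field_simps)
qed simp

section \<open>Integral operators with bounded kernels\<close>

text \<open>
  The Hilbert-Schmidt norm, that is the norm of \<open>K\<close> in \<open>L\<^sup>2\<close> of the square, written as an
  iterated norm because it is estimated section by section.
\<close>
definition HS_norm :: "(real \<times> real \<Rightarrow> real) \<Rightarrow> real" where
  "HS_norm K = L2norm (\<lambda>x. L2norm (\<lambda>y. K (x, y)))"

definition kernel_op :: "(real \<times> real \<Rightarrow> real) \<Rightarrow> (real \<Rightarrow> real) \<Rightarrow> real \<Rightarrow> real" where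
  "kernel_op K f x = (LINT y|unit_measure. K (x, y) * f y)"

definition bounded_kernel :: "real \<Rightarrow> (real \<times> real \<Rightarrow> real) \<Rightarrow> bool" where
  "bounded_kernel b K \<longleftrightarrow> K \<in> borel_measurable (unit_measure \<Otimes>\<^sub>M unit_measure) \<and>
     (\<forall>x\<in>{0..1}. \<forall>y\<in>{0..1}. \<bar>K (x, y)\<bar> \<le> b)"

lemma bounded_kernel_nonneg: "bounded_kernel b K \<Longrightarrow> 0 \<le> b"
  unfolding bounded_kernel_def by (meson abs_ge_zero atLeastAtMost_iff order_refl order_trans zero_le_one)

lemma bounded_kernel_section:
  assumes "bounded_kernel b K" and "x \<in> {0..1}"
  shows "(\<lambda>y. K (x, y)) \<in> borel_measurable unit_measure"
  using assms measurable_Pair2[of K unit_measure unit_measure borel x] by (simp add: bounded_kernel_def)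

lemma bounded_kernel_section_L2:
  assumes "bounded_kernel b K" and "x \<in> {0..1}"
  shows "(\<lambda>y. K (x, y)) \<in> L2"
  using assms by (intro L2_bounded[of _ b] bounded_kernel_section) (auto simp: bounded_kernel_def)

lemma bounded_kernel_section_norm:
  assumes "bounded_kernel b K" and "x \<in> {0..1}"
  shows "L2norm (\<lambda>y. K (x, y)) \<le> b"
  using assms bounded_kernel_nonneg[OF assms(1)]
  by (intro L2norm_le_bounded bounded_kernel_section) (auto simp: bounded_kernel_def)

lemma bounded_kernel_section_norm_measurable:
  assumes "bounded_kernel b K"
  shows "(\<lambda>x. L2norm (\<lambda>y. K (x, y))) \<in> borel_measurable unit_measure"
proof -
  have [measurable]: "K \<in> borel_measurable (unit_measure \<Otimes>\<^sub>M unit_measure)"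
    using assms by (simp add: bounded_kernel_def)
  have "(\<lambda>x. LINT y|unit_measure. (K (x, y))\<^sup>2) \<in> borel_measurable unit_measure"
    by (rule sigma_finite_measure.borel_measurable_lebesgue_integral[OF sigma_finite_unit_measure])
      measurable
  then show ?thesis
    unfolding L2norm_def by (rule measurable_compose) simp
qed

lemma bounded_kernel_section_norm_L2:
  assumes "bounded_kernel b K"
  shows "(\<lambda>x. L2norm (\<lambda>y. K (x, y))) \<in> L2"
  using bounded_kernel_section_norm_measurable[OF assms] bounded_kernel_section_norm[OF assms]
  by (intro L2_bounded[of _ b]) auto

lemma HS_norm_nonneg [simp]: "0 \<le> HS_norm K"
  by (simp add: HS_norm_def)

lemma HS_norm_le:
  assumes "bounded_kernel b K"
  shows "HS_norm K \<le> b"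
  unfolding HS_norm_def
  using bounded_kernel_section_norm_measurable[OF assms] bounded_kernel_section_norm[OF assms]
    bounded_kernel_nonneg[OF assms]
  by (intro L2norm_le_bounded) auto

lemma kernel_op_pointwise:
  assumes "bounded_kernel b K" and "f \<in> L2" and "x \<in> {0..1}"
  shows "\<bar>kernel_op K f x\<bar> \<le> L2norm (\<lambda>y. K (x, y)) * L2norm f"
  using L2_Cauchy_Schwarz[OF bounded_kernel_section_L2[OF assms(1,3)] assms(2)]
  by (simp add: kernel_op_def L2_inner_def)

lemma kernel_op_L2:
  assumes "bounded_kernel b K" and "f \<in> L2"
  shows "kernel_op K f \<in> L2"
proof (rule L2_bounded)
  have [measurable]: "K \<in> borel_measurable (unit_measure \<Otimes>\<^sub>M unit_measure)"
    "f \<in> borel_measurable unit_measure"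
    using assms by (simp_all add: bounded_kernel_def L2_measurable)
  have "(\<lambda>(x, y). K (x, y) * f y) \<in> borel_measurable (unit_measure \<Otimes>\<^sub>M unit_measure)"
    by measurable
  then show "kernel_op K f \<in> borel_measurable unit_measure"
    unfolding kernel_op_def[abs_def]
    by (rule sigma_finite_measure.borel_measurable_lebesgue_integral[OF sigma_finite_unit_measure])
  show "\<bar>kernel_op K f x\<bar> \<le> b * L2norm f" if "x \<in> {0..1}" for x
    using kernel_op_pointwise[OF assms that]
      mult_right_mono[OF bounded_kernel_section_norm[OF assms(1) that] L2norm_nonneg, of f]
    by linarith
qed

lemma kernel_op_norm_le:
  assumes "bounded_kernel b K" and "f \<in> L2"
  shows "L2norm (kernel_op K f) \<le> HS_norm K * L2norm f"
proof -
  have "L2norm (kernel_op K f) \<le> L2norm (\<lambda>x. L2norm f * L2norm (\<lambda>y. K (x, y)))"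
    using kernel_op_pointwise[OF assms]
    by (intro L2norm_mono kernel_op_L2[OF assms] L2_scale bounded_kernel_section_norm_L2[OF assms(1)])
      (auto simp: mult.commute)
  then show ?thesis
    by (simp add: L2norm_scale HS_norm_def mult.commute)
qed

lemma kernel_op_diff_right:
  assumes "bounded_kernel b K" and "f \<in> L2" and "g \<in> L2" and "x \<in> {0..1}"
  shows "kernel_op K (\<lambda>y. f y - g y) x = kernel_op K f x - kernel_op K g x"
  using L2_inner_diff_right[OF bounded_kernel_section_L2[OF assms(1,4)] assms(2,3)]
  by (simp add: kernel_op_def L2_inner_def)

lemma kernel_op_diff_left:
  assumes "bounded_kernel b K" and "bounded_kernel b' L" and "f \<in> L2" and "x \<in> {0..1}"
  shows "kernel_op (\<lambda>p. K p - L p) f x = kernel_op K f x - kernel_op L f x"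
  using L2_inner_diff_right[OF assms(3) bounded_kernel_section_L2[OF assms(1,4)]
      bounded_kernel_section_L2[OF assms(2,4)]]
  by (simp add: kernel_op_def L2_inner_def mult.commute)

text \<open>
  The kernel \<open>k\<close> may fail to be measurable for the product measure, as can happen with a Lebesgue
  measurable graphon. Its operator is nevertheless that of any bounded measurable kernel with almost
  everywhere equal sections.
\<close>
lemma kernel_op_cong_AE:
  assumes "bounded_kernel b L" and "f \<in> L2"
    and "AE x in unit_measure. AE y in unit_measure. L (x, y) = k (x, y)"
  shows "AE x in unit_measure. kernel_op k f x = kernel_op L f x"
  using assms(3) AE_space
proof eventually_elim
  case (elim x)
  then have "x \<in> {0..1}"
    by simp
  have meas: "(\<lambda>y. L (x, y) * f y) \<in> borel_measurable unit_measure"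
    using bounded_kernel_section[OF assms(1) \<open>x \<in> {0..1}\<close>] L2_measurable[OF assms(2)] by simp
  have AE: "AE y in unit_measure. L (x, y) * f y = k (x, y) * f y"
    using elim(1) by eventually_elim simp
  show ?case
    unfolding kernel_op_def
    using integral_cong_AE[OF meas unit_measurable_AE[OF meas AE] AE] by simp
qed

lemma bounded_kernel_diff:
  assumes "bounded_kernel b K" and "bounded_kernel b' L"
  shows "bounded_kernel (b + b') (\<lambda>p. K p - L p)"
  using assms unfolding bounded_kernel_def
  by (auto intro!: borel_measurable_diff) (smt (verit) atLeastAtMost_iff)

text \<open>
  Convergence on almost all sections does not make \<open>k\<close> measurable as a function of two variables.
  The pointwise limit of the \<open>K n\<close>, clamped to \<open>[-b, b]\<close> to control it where the sequence
  diverges, is measurable by construction and takes the place of \<open>k\<close>. Convergence in norm then follows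
  by applying dominated convergence twice, first on almost every section and then to the norms of the
  sections.
\<close>
lemma HS_norm_limit:
  fixes k :: "real \<times> real \<Rightarrow> real"
  assumes K: "\<And>n. bounded_kernel b (K n)"
    and lim: "AE x in unit_measure. AE y in unit_measure. (\<lambda>n. K n (x, y)) \<longlonglongrightarrow> k (x, y)"
  obtains L where "bounded_kernel b L"
    and "AE x in unit_measure. AE y in unit_measure. L (x, y) = k (x, y)"
    and "(\<lambda>n. HS_norm (\<lambda>p. K n p - L p)) \<longlonglongrightarrow> 0"
proof -
  have "0 \<le> b"
    using bounded_kernel_nonneg[OF K] .
  define L where "L p = max (- b) (min b (lim (\<lambda>n. K n p)))" for p
  have [measurable]: "K n \<in> borel_measurable (unit_measure \<Otimes>\<^sub>M unit_measure)" for n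
    using K by (simp add: bounded_kernel_def)
  have "L \<in> borel_measurable (unit_measure \<Otimes>\<^sub>M unit_measure)"
    unfolding L_def[abs_def] by measurable
  then have L: "bounded_kernel b L"
    using \<open>0 \<le> b\<close> by (auto simp: bounded_kernel_def L_def)
  have conv: "AE x in unit_measure. x \<in> {0..1} \<and>
      (AE y in unit_measure. y \<in> {0..1} \<and> (\<lambda>n. K n (x, y)) \<longlonglongrightarrow> k (x, y))"
    using lim AE_space by eventually_elim (auto intro: AE_mp[OF AE_space])
  have L_eq: "L (x, y) = k (x, y)"
    if "x \<in> {0..1}" "y \<in> {0..1}" "(\<lambda>n. K n (x, y)) \<longlonglongrightarrow> k (x, y)" for x y
  proof -
    have "\<bar>K n (x, y)\<bar> \<le> b" for n
      using K that by (simp add: bounded_kernel_def)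
    then have "- b \<le> k (x, y)" "k (x, y) \<le> b"
      using that(3) by (auto simp: abs_le_iff intro!: LIMSEQ_le_const[OF that(3)] LIMSEQ_le_const2[OF that(3)])
        (metis minus_le_iff)
    then show ?thesis
      using limI[OF that(3)] by (simp add: L_def)
  qed
  have "AE x in unit_measure. AE y in unit_measure. L (x, y) = k (x, y)"
    using conv
  proof eventually_elim
    case (elim x)
    show ?case
      using conjunct2[OF elim] by eventually_elim (use elim in \<open>blast intro: L_eq\<close>)
  qed
  moreover have "(\<lambda>n. HS_norm (\<lambda>p. K n p - L p)) \<longlonglongrightarrow> 0"
    unfolding HS_norm_def
  proof (rule L2norm_bounded_convergence)
    note diff = bounded_kernel_diff[OF K L]
    show "(\<lambda>x. L2norm (\<lambda>y. K n (x, y) - L (x, y))) \<in> borel_measurable unit_measure" for n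
      using bounded_kernel_section_norm_measurable[OF diff] .
    show "\<bar>L2norm (\<lambda>y. K n (x, y) - L (x, y))\<bar> \<le> b + b" if "x \<in> {0..1}" for n x
      using bounded_kernel_section_norm[OF diff that] by simp
    show "AE x in unit_measure. (\<lambda>n. L2norm (\<lambda>y. K n (x, y) - L (x, y))) \<longlonglongrightarrow> 0"
      using conv
    proof eventually_elim
      case (elim x)
      show ?case
      proof (rule L2norm_bounded_convergence)
        show "(\<lambda>y. K n (x, y) - L (x, y)) \<in> borel_measurable unit_measure" for n
          using bounded_kernel_section[OF diff] elim by blast
        show "\<bar>K n (x, y) - L (x, y)\<bar> \<le> b + b" if "y \<in> {0..1}" for n y
          using diff elim that by (simp add: bounded_kernel_def)
        show "AE y in unit_measure. (\<lambda>n. K n (x, y) - L (x, y)) \<longlonglongrightarrow> 0"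
          using conjunct2[OF elim]
        proof eventually_elim
          case (elim y)
          then show ?case
            using L_eq \<open>x \<in> {0..1} \<and> _\<close> by (simp add: LIM_zero_iff)
        qed
      qed
    qed
  qed
  ultimately show thesis
    using that L by blast
qed

text \<open>
  The difference \<open>v = u - w\<close> satisfies \<open>v' = K v + (K - L) w - v\<close>. The term \<open>- v\<close> only
  decreases the norm, whence
  \<open>2 \<langle>v, v'\<rangle> \<le> 2 b \<parallel>v\<parallel>\<^sup>2 + 2 \<parallel>v\<parallel> \<parallel>K - L\<parallel> R\<close>, and the inequality between the arithmetic and
  the geometric mean separates the mixed term.
\<close>
lemma kernel_flow_perturbation:
  assumes K: "bounded_kernel b K" and L: "bounded_kernel b L"
    and u: "L2_has_derivative u u'" and w: "L2_has_derivative w w'"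
    and u': "\<And>t. 0 \<le> t \<Longrightarrow> AE x in unit_measure. u' t x = kernel_op K (u t) x - u t x"
    and w': "\<And>t. 0 \<le> t \<Longrightarrow> AE x in unit_measure. w' t x = kernel_op L (w t) x - w t x"
    and "0 \<le> T" and R: "\<forall>t\<in>{0..T}. L2norm (w t) \<le> R"
  shows "(L2norm (\<lambda>x. u T x - w T x))\<^sup>2 \<le> exp ((2 * b + 1) * T)
    * ((L2norm (\<lambda>x. u 0 x - w 0 x))\<^sup>2 + (HS_norm (\<lambda>p. K p - L p) * R)\<^sup>2 * T)"
proof (rule L2_energy_estimate[OF L2_has_derivative_diff[OF u w] \<open>0 \<le> T\<close>])
  show "0 \<le> 2 * b + 1"
    using bounded_kernel_nonneg[OF K] by simp
  fix t assume t: "0 < t" "t < T"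
  define D where "D = (\<lambda>p. K p - L p)"
  have D: "bounded_kernel (b + b) D"
    unfolding D_def using K L by (rule bounded_kernel_diff)
  define v where "v = (\<lambda>x. u t x - w t x)"
  define v' where "v' = (\<lambda>x. u' t x - w' t x)"
  have L2: "u t \<in> L2" "w t \<in> L2" "u' t \<in> L2" "w' t \<in> L2"
    using u w t unfolding L2_has_derivative_def by auto
  then have v: "v \<in> L2" and v'_L2: "v' \<in> L2"
    unfolding v_def v'_def by (auto intro: L2_diff)
  note Kv = kernel_op_L2[OF K v] and Dw = kernel_op_L2[OF D L2(2)]
  have "AE x in unit_measure. v' x = kernel_op K v x + kernel_op D (w t) x - v x"
    using u'[OF less_imp_le[OF t(1)]] w'[OF less_imp_le[OF t(1)]] AE_space
  proof eventually_elim
    case (elim x)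
    then have x: "x \<in> {0..1}"
      by simp
    show ?case
      unfolding v_def D_def
      using elim kernel_op_diff_right[OF K L2(1,2) x] kernel_op_diff_left[OF K L L2(2) x]
      by (simp add: v'_def)
  qed
  then have "L2_inner v v' = L2_inner v (\<lambda>x. kernel_op K v x + kernel_op D (w t) x - v x)"
    using v v'_L2 Kv Dw by (intro L2_inner_cong_AE L2_diff L2_add) auto
  also have "\<dots> = L2_inner v (kernel_op K v) + L2_inner v (kernel_op D (w t)) - (L2norm v)\<^sup>2"
    using v Kv Dw by (simp add: L2_inner_diff_right L2_inner_add_right L2_add L2norm_power2_inner)
  also have "\<dots> \<le> L2_inner v (kernel_op K v) + L2_inner v (kernel_op D (w t))"
    by simp
  also have "L2_inner v (kernel_op K v) \<le> b * (L2norm v)\<^sup>2"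
  proof -
    have "L2_inner v (kernel_op K v) \<le> L2norm v * L2norm (kernel_op K v)"
      using L2_Cauchy_Schwarz[OF v Kv] by simp
    also have "\<dots> \<le> L2norm v * (b * L2norm v)"
      by (intro mult_left_mono order_trans[OF kernel_op_norm_le[OF K v]] mult_right_mono HS_norm_le[OF K])
        simp_all
    finally show ?thesis
      by (simp add: power2_eq_square mult_ac)
  qed
  also have "L2_inner v (kernel_op D (w t)) \<le> L2norm v * (HS_norm D * R)"
  proof -
    have "L2_inner v (kernel_op D (w t)) \<le> L2norm v * L2norm (kernel_op D (w t))"
      using L2_Cauchy_Schwarz[OF v Dw] by simp
    also have "\<dots> \<le> L2norm v * (HS_norm D * R)"
      using R t
      by (intro mult_left_mono order_trans[OF kernel_op_norm_le[OF D L2(2)]]) simp_all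
    finally show ?thesis .
  qed
  finally have "2 * L2_inner v v' \<le> 2 * b * (L2norm v)\<^sup>2 + 2 * L2norm v * (HS_norm D * R)"
    by simp
  also have "\<dots> \<le> (2 * b + 1) * (L2norm v)\<^sup>2 + (HS_norm D * R)\<^sup>2"
    using sum_squares_bound[of "L2norm v" "HS_norm D * R"] by (simp add: distrib_right)
  finally show "2 * L2_inner (\<lambda>x. u t x - w t x) (\<lambda>x. u' t x - w' t x)
      \<le> (2 * b + 1) * (L2norm (\<lambda>x. u t x - w t x))\<^sup>2 + (HS_norm (\<lambda>p. K p - L p) * R)\<^sup>2"
    by (simp add: v_def v'_def D_def)
qed simp

section \<open>Sampled step graphons\<close>

text \<open>
  The index of the part of the uniform partition that contains \<open>x\<close>. The minimum accounts for
  \<open>x = 1\<close>, which belongs to the last part.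
\<close>
definition cell :: "nat \<Rightarrow> real \<Rightarrow> nat" where
  "cell n x = min n (nat \<lfloor>real n * x\<rfloor> + 1)"

lemma cell_range: "1 \<le> n \<Longrightarrow> cell n x \<in> {1..n}"
  by (simp add: cell_def)

lemma mem_uniform_part_iff:
  assumes "1 \<le> n" and "i \<in> {1..n}" and "x \<in> {0..1}"
  shows "x \<in> uniform_part n i \<longleftrightarrow> i = cell n x"
proof -
  define z where "z = \<lfloor>real n * x\<rfloor>"
  have z: "0 \<le> z" "cell n x = min n (nat z + 1)"
    using assms by (simp_all add: z_def cell_def)
  show ?thesis
  proof (cases "i = n")
    case True
    have "x \<in> uniform_part n i \<longleftrightarrow> real n - 1 \<le> real n * x"
      using True assms by (simp add: uniform_part_def divide_le_eq mult.commute)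
    also have "\<dots> \<longleftrightarrow> int n - 1 \<le> z"
      by (simp add: le_floor_iff z_def)
    also have "\<dots> \<longleftrightarrow> i = cell n x"
      unfolding z(2) using True z(1) by arith
    finally show ?thesis .
  next
    case False
    have "x \<in> uniform_part n i \<longleftrightarrow> real i - 1 \<le> real n * x \<and> real n * x < real i"
      using False assms by (simp add: uniform_part_def divide_le_eq less_divide_eq mult.commute)
    also have "\<dots> \<longleftrightarrow> z = int i - 1"
      by (simp add: floor_eq_iff z_def)
    also have "\<dots> \<longleftrightarrow> i = cell n x"
      unfolding z(2) using False z(1) assms(2) by (simp add: min_def) arith
    finally show ?thesis .
  qed
qed

lemma cell_bounds:
  assumes "1 \<le> n" and "x \<in> {0..1}"
  shows "(real (cell n x) - 1) / real n \<le> x" and "x \<le> real (cell n x) / real n"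
  using mem_uniform_part_iff[OF assms(1) cell_range[OF assms(1)] assms(2), of x] assms
  by (auto simp: uniform_part_def split: if_splits)

lemma uniform_part_subset:
  assumes "i \<in> {1..n}" shows "uniform_part n i \<subseteq> {0..1}"
proof
  fix x assume "x \<in> uniform_part n i"
  then have "(real i - 1) / real n \<le> x \<and> x \<le> real i / real n"
    using assms by (auto simp: uniform_part_def split: if_splits)
  moreover have "0 \<le> (real i - 1) / real n" "real i / real n \<le> 1"
    using assms by auto
  ultimately show "x \<in> {0..1}"
    by simp
qed

lemma uniform_part_dist:
  assumes "1 \<le> n" and "x \<in> {0..1}" and "y \<in> {0..1}" and "cell n x = cell n y"
  shows "\<bar>x - y\<bar> \<le> 1 / real n"
  using cell_bounds[OF assms(1,2)] cell_bounds[OF assms(1,3)] assms(4)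
  by (simp add: diff_divide_distrib)

lemma tendsto_cell:
  assumes "x \<in> {0..1}"
  shows "(\<lambda>n. real (cell n x) / real n) \<longlonglongrightarrow> x"
proof (rule LIM_zero_cancel, rule Lim_null_comparison)
  show "\<forall>\<^sub>F n in sequentially. norm (real (cell n x) / real n - x) \<le> 1 / real n"
    using eventually_ge_at_top[of 1]
  proof eventually_elim
    case (elim n)
    then show ?case
      using cell_bounds[OF elim assms] by (simp add: diff_divide_distrib)
  qed
qed (rule lim_1_over_n)

lemma sum_cell:
  fixes a :: "nat \<Rightarrow> real"
  assumes "1 \<le> n" and "x \<in> {0..1}"
  shows "(\<Sum>i=1..n. a i * indicator (uniform_part n i) x) = a (cell n x)"
proof -
  have "(\<Sum>i=1..n. a i * indicator (uniform_part n i) x) = (\<Sum>i=1..n. if i = cell n x then a i else 0)"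
    using mem_uniform_part_iff[OF assms(1) _ assms(2)]
    by (intro sum.cong) (auto simp: indicator_def)
  also have "\<dots> = a (cell n x)"
    using cell_range[OF assms(1), of x] by simp
  finally show ?thesis .
qed

lemma step_graphon_cell:
  assumes "1 \<le> n" and "x \<in> {0..1}" and "y \<in> {0..1}"
  shows "step_graphon n A (x, y) = A (cell n x) (cell n y)"
proof -
  have "step_graphon n A (x, y)
      = (\<Sum>i=1..n. (\<Sum>j=1..n. A i j * indicator (uniform_part n j) y) * indicator (uniform_part n i) x)"
    unfolding step_graphon_def prod.case sum_distrib_right
    by (intro sum.cong refl) (simp only: mult_ac)
  also have "\<dots> = A (cell n x) (cell n y)"
    by (simp only: sum_cell[OF assms(1,2)] sum_cell[OF assms(1,3)])
  finally show ?thesis .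
qed

text \<open>
  The value of the step graphon at \<open>(x, y)\<close> is the value of \<open>W\<close> at the upper right corner of
  the cell of \<open>(x, y)\<close>, and these corners converge to \<open>(x, y)\<close>.
\<close>
lemma sampled_step_graphon_tendsto:
  assumes "x \<in> {0..1}" and "y \<in> {0..1}"
    and "continuous (at (x, y) within {0..1} \<times> {0..1}) W"
  shows "(\<lambda>n. step_graphon n (sampled_graph W n) (x, y)) \<longlonglongrightarrow> W (x, y)"
proof -
  \<comment> \<open>At \<open>n = 0\<close> division by zero would give the origin; any point of the square serves.\<close>
  define p where "p n = (if n = 0 then (x, y) else (real (cell n x) / real n, real (cell n y) / real n))" for n
  have "p n \<in> {0..1} \<times> {0..1}" for n
    using assms cell_range[of n x] cell_range[of n y] by (auto simp: p_def)
  moreover have "p \<longlonglongrightarrow> (x, y)"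
  proof (rule Lim_transform_eventually)
    show "(\<lambda>n. (real (cell n x) / real n, real (cell n y) / real n)) \<longlonglongrightarrow> (x, y)"
      using assms by (intro tendsto_Pair tendsto_cell)
    show "\<forall>\<^sub>F n in sequentially. (real (cell n x) / real n, real (cell n y) / real n) = p n"
      using eventually_gt_at_top[of 0] by eventually_elim (simp add: p_def)
  qed
  ultimately have "(\<lambda>n. W (p n)) \<longlonglongrightarrow> W (x, y)"
    using assms(3) by (simp add: continuous_within_sequentially o_def)
  moreover have "\<forall>\<^sub>F n in sequentially. W (p n) = step_graphon n (sampled_graph W n) (x, y)"
    using eventually_ge_at_top[of 1]
    by eventually_elim (use assms in \<open>simp add: p_def step_graphon_cell sampled_graph_def\<close>)
  ultimately show ?thesis
    by (rule Lim_transform_eventually)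
qed

lemma sets_uniform_part [measurable]: "uniform_part n i \<in> sets borel"
  by (simp add: uniform_part_def)

lemma uniform_part_measurable [measurable]:
  "(indicator (uniform_part n i) :: real \<Rightarrow> real) \<in> borel_measurable unit_measure"
  by (intro measurable_restrict_space1 measurable_completion) measurable

lemma step_graphon_measurable [measurable]:
  "step_graphon n A \<in> borel_measurable (unit_measure \<Otimes>\<^sub>M unit_measure)"
  unfolding step_graphon_def by measurable

lemma step_graphon_degree_measurable [measurable]:
  "graphon_degree (step_graphon n A) \<in> borel_measurable unit_measure"
  unfolding graphon_degree_def[abs_def]
  by (rule sigma_finite_measure.borel_measurable_lebesgue_integral[OF sigma_finite_unit_measure]) measurable

lemma sampled_step_graphon_bounds:
  assumes "graphon W" and "1 \<le> n" and "x \<in> {0..1}" and "y \<in> {0..1}"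
  shows "0 \<le> step_graphon n (sampled_graph W n) (x, y)"
    and "step_graphon n (sampled_graph W n) (x, y) \<le> 1"
proof -
  have "real (cell n x) / real n \<in> {0..1}" "real (cell n y) / real n \<in> {0..1}"
    using cell_range[OF assms(2), of x] cell_range[OF assms(2), of y] by auto
  then show "0 \<le> step_graphon n (sampled_graph W n) (x, y)"
    "step_graphon n (sampled_graph W n) (x, y) \<le> 1"
    using assms unfolding graphon_def by (auto simp: step_graphon_cell sampled_graph_def)
qed

text \<open>
  Two-dimensional Lebesgue measure is the completion of a product measure, so a Lebesgue null set is
  first enlarged to a Borel null set before Fubini's theorem applies.
\<close>
lemma AE_unit_square_sections:
  assumes "{p \<in> {0..1} \<times> {0..1}. \<not> P p} \<in> null_sets (lebesgue :: (real \<times> real) measure)"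
  shows "AE x in unit_measure. AE y in unit_measure. P (x, y)"
proof -
  have pair: "pair_sigma_finite (lborel :: real measure) (lborel :: real measure)"
    by (intro pair_sigma_finite.intro lborel.sigma_finite_measure_axioms)
  have "AE p in lebesgue. p \<notin> {p \<in> {0..1} \<times> {0..1}. \<not> P p}"
    using assms by (rule AE_not_in)
  then have "AE p in lborel. p \<in> {0..1} \<times> {0..1} \<longrightarrow> P p"
    by (simp add: AE_completion_iff)
  then have "AE p in lborel \<Otimes>\<^sub>M lborel. p \<in> {0..1} \<times> {0..1} \<longrightarrow> P p"
    by (simp only: lborel_prod)
  from pair_sigma_finite.AE_pair[OF pair this]
  have "AE x in lebesgue. AE y in lebesgue. (x, y) \<in> {0..1} \<times> {0..1} \<longrightarrow> P (x, y)"
    by (simp add: AE_completion_iff)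
  then have "AE x in lebesgue. x \<in> {0..1} \<longrightarrow> (AE y in lebesgue. y \<in> {0..1} \<longrightarrow> P (x, y))"
    by eventually_elim (auto elim: eventually_mono)
  then show ?thesis
    by (simp add: AE_restrict_space_iff)
qed

lemma AE_sampled_step_graphon_tendsto:
  assumes "ae_continuous W"
  shows "AE x in unit_measure. AE y in unit_measure.
    (\<lambda>n. step_graphon n (sampled_graph W n) (x, y)) \<longlonglongrightarrow> W (x, y)"
proof -
  have "AE x in unit_measure. AE y in unit_measure. continuous (at (x, y) within {0..1} \<times> {0..1}) W"
    using assms unfolding ae_continuous_def by (rule AE_unit_square_sections)
  then show ?thesis
    using AE_space
  proof eventually_elim
    case (elim x)
    show ?case
      using elim(1) AE_space
      by eventually_elim (use elim(2) in \<open>auto intro: sampled_step_graphon_tendsto\<close>)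
  qed
qed

lemma sampled_step_graphon_degree_tendsto:
  assumes "graphon W" and "x \<in> {0..1}" and "integrable unit_measure (\<lambda>y. W (x, y))"
    and "AE y in unit_measure. (\<lambda>n. step_graphon n (sampled_graph W n) (x, y)) \<longlonglongrightarrow> W (x, y)"
  shows "(\<lambda>n. graphon_degree (step_graphon n (sampled_graph W n)) x) \<longlonglongrightarrow> graphon_degree W x"
proof -
  let ?\<eta> = "\<lambda>n. step_graphon (Suc n) (sampled_graph W (Suc n))"
  have "(\<lambda>n. LINT y|unit_measure. ?\<eta> n (x, y)) \<longlonglongrightarrow> (LINT y|unit_measure. W (x, y))"
  proof (rule integral_dominated_convergence[where w = "\<lambda>_. 1"])
    show "(\<lambda>y. W (x, y)) \<in> borel_measurable unit_measure"
      using assms(3) by simp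
    show "(\<lambda>y. ?\<eta> n (x, y)) \<in> borel_measurable unit_measure" for n
      using assms(2) measurable_Pair2[OF step_graphon_measurable, of x] by simp
    show "integrable unit_measure (\<lambda>_. 1 :: real)"
      by (rule integrable_unit_measure_bounded[where B = 1]) auto
    show "AE y in unit_measure. (\<lambda>n. ?\<eta> n (x, y)) \<longlonglongrightarrow> W (x, y)"
      using assms(4) by eventually_elim (rule LIMSEQ_Suc)
    show "AE y in unit_measure. norm (?\<eta> n (x, y)) \<le> 1" for n
      using sampled_step_graphon_bounds[OF assms(1) _ assms(2), of "Suc n"] by (intro AE_I2) simp
  qed
  then show ?thesis
    unfolding graphon_degree_def by (rule LIMSEQ_imp_Suc)
qed

section \<open>Averaging over the uniform partition\<close>

definition part_indicator :: "nat \<Rightarrow> nat \<Rightarrow> real \<Rightarrow> real" where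
  "part_indicator n i = indicator (uniform_part n i)"

lemma part_indicator_L2: "part_indicator n i \<in> L2"
  by (rule L2_bounded[of _ 1]) (auto simp: part_indicator_def indicator_def)

text \<open>
  The expansion of the averages in the orthogonal system of the indicators of the parts, each of which has
  squared norm \<open>1 / n\<close>.
\<close>
lemma averaged_eq:
  "averaged n g = (\<lambda>x. \<Sum>i=1..n. real n * L2_inner (part_indicator n i) g * part_indicator n i x)"
proof
  fix x
  have "(LINT y|lebesgue_on (uniform_part n i). g y) = L2_inner (part_indicator n i) g"
    if "i \<in> {1..n}" for i
    using uniform_part_subset[OF that]
    by (auto simp: L2_inner_def integral_restrict_space part_indicator_def indicator_def
        intro!: Bochner_Integration.integral_cong)
  then show "averaged n g x = (\<Sum>i=1..n. real n * L2_inner (part_indicator n i) g * part_indicator n i x)"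
    unfolding averaged_def sum_distrib_left
    by (intro sum.cong refl) (simp add: part_indicator_def mult.assoc)
qed

lemma averaged_L2: "averaged n g \<in> L2"
  unfolding averaged_eq by (intro L2_sum L2_scale part_indicator_L2)

lemma part_indicator_orthogonal:
  assumes "1 \<le> n" and "i \<in> {1..n}" and "j \<in> {1..n}"
  shows "L2_inner (part_indicator n i) (part_indicator n j) = (if i = j then 1 / real n else 0)"
proof -
  have "L2_inner (part_indicator n i) (part_indicator n j)
      = (LINT x|unit_measure. (if i = j then part_indicator n i x else 0))"
    unfolding L2_inner_def
    using mem_uniform_part_iff[OF assms(1,2)] mem_uniform_part_iff[OF assms(1,3)]
    by (intro Bochner_Integration.integral_cong) (auto simp: part_indicator_def indicator_def)
  also have "\<dots> = (if i = j then measure lebesgue (uniform_part n i) else 0)"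
    using uniform_part_subset[OF assms(2)]
    by (auto simp: part_indicator_def measure_restrict_space Int_absorb2)
  also have "measure lebesgue (uniform_part n i) = 1 / real n"
    using assms by (auto simp: uniform_part_def diff_divide_distrib divide_right_mono)
  finally show ?thesis .
qed

lemma L2_inner_averaged:
  assumes "f \<in> L2"
  shows "L2_inner f (averaged n g)
    = (\<Sum>i=1..n. real n * L2_inner (part_indicator n i) g * L2_inner (part_indicator n i) f)"
  unfolding averaged_eq
  using assms
  by (subst L2_inner_sum_right)
    (simp_all add: L2_scale part_indicator_L2 L2_inner_scale_right L2_inner_commute[of f])

text \<open>
  Averaging is the orthogonal projection \<open>P\<close> onto the step functions, so
  \<open>\<parallel>P g\<parallel>\<^sup>2 = \<langle>g, P g\<rangle> \<le> \<parallel>g\<parallel> \<parallel>P g\<parallel>\<close>.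
\<close>
lemma averaged_norm_le:
  assumes "g \<in> L2"
  shows "L2norm (averaged n g) \<le> L2norm g"
proof -
  have part: "L2_inner (part_indicator n i) (averaged n g) = L2_inner (part_indicator n i) g"
    if "i \<in> {1..n}" for i
  proof -
    have "1 \<le> n"
      using that by simp
    have "L2_inner (part_indicator n i) (averaged n g)
        = (\<Sum>j=1..n. if j = i then L2_inner (part_indicator n j) g else 0)"
      unfolding L2_inner_averaged[OF part_indicator_L2]
      using part_indicator_orthogonal[OF \<open>1 \<le> n\<close> _ that] \<open>1 \<le> n\<close> by (intro sum.cong) auto
    also have "\<dots> = L2_inner (part_indicator n i) g"
      using that by simp
    finally show ?thesis .
  qed
  have "(L2norm (averaged n g))\<^sup>2 = L2_inner (averaged n g) (averaged n g)"
    by (rule L2norm_power2_inner)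
  also have "\<dots> = L2_inner g (averaged n g)"
    unfolding L2_inner_averaged[OF averaged_L2] L2_inner_averaged[OF assms]
    by (intro sum.cong) (auto simp: part)
  also have "\<dots> \<le> L2norm g * L2norm (averaged n g)"
    using L2_Cauchy_Schwarz[OF assms averaged_L2] by (rule abs_le_D1)
  finally have "L2norm (averaged n g) * L2norm (averaged n g) \<le> L2norm g * L2norm (averaged n g)"
    by (simp add: power2_eq_square)
  then show ?thesis
    by (cases "L2norm (averaged n g) = 0") (auto simp: mult_le_cancel_right less_le)
qed

lemma averaged_diff:
  assumes "f \<in> L2" and "g \<in> L2"
  shows "averaged n (\<lambda>y. f y - g y) x = averaged n f x - averaged n g x"
  using assms
  by (simp add: averaged_eq L2_inner_diff_right part_indicator_L2 sum_subtractf[symmetric] algebra_simps)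

text \<open>
  The average is a mean of values of \<open>h\<close> at distance at most \<open>1 / n\<close> from \<open>x\<close>. With
  \<open>a = h x\<close> this gives convergence at points of continuity, with \<open>a = 0\<close> a uniform bound.
\<close>
lemma averaged_near:
  assumes "h \<in> L2" and "1 \<le> n" and "x \<in> {0..1}"
    and near: "\<And>y. y \<in> {0..1} \<Longrightarrow> \<bar>x - y\<bar> \<le> 1 / real n \<Longrightarrow> \<bar>h y - a\<bar> \<le> e"
  shows "\<bar>averaged n h x - a\<bar> \<le> e"
proof -
  let ?\<chi> = "part_indicator n (cell n x)"
  note range = cell_range[OF assms(2), of x]
  have "(\<lambda>y. ?\<chi> y * ?\<chi> y) = ?\<chi>"
    by (auto simp: part_indicator_def indicator_def)
  then have one: "(LINT y|unit_measure. ?\<chi> y) = 1 / real n"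
    using part_indicator_orthogonal[OF assms(2) range range] by (simp add: L2_inner_def)
  have avg: "averaged n h x = real n * L2_inner ?\<chi> h"
    unfolding averaged_eq part_indicator_def
    using sum_cell[OF assms(2,3), of "\<lambda>i. real n * L2_inner (part_indicator n i) h"]
    by (simp only: part_indicator_def)
  have int: "integrable unit_measure (\<lambda>y. ?\<chi> y * h y)" "integrable unit_measure ?\<chi>"
    by (intro L2_integrable_mult L2_integrable part_indicator_L2 assms(1))+
  have "\<bar>LINT y|unit_measure. ?\<chi> y * h y - a * ?\<chi> y\<bar> \<le> (LINT y|unit_measure. e * ?\<chi> y)"
  proof (rule integral_abs_bound_integral)
    fix y assume "y \<in> space unit_measure"
    then have y: "y \<in> {0..1}"
      by simp
    show "\<bar>?\<chi> y * h y - a * ?\<chi> y\<bar> \<le> e * ?\<chi> y"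
      using near[OF y] uniform_part_dist[OF assms(2,3) y] mem_uniform_part_iff[OF assms(2) range y]
      by (auto simp: part_indicator_def indicator_def)
  qed (use int in auto)
  then have "\<bar>L2_inner ?\<chi> h - a / real n\<bar> \<le> e / real n"
    using int one by (simp add: L2_inner_def)
  then have "real n * \<bar>L2_inner ?\<chi> h - a / real n\<bar> \<le> e"
    using assms(2) by (simp add: field_simps)
  then have "\<bar>real n * (L2_inner ?\<chi> h - a / real n)\<bar> \<le> e"
    by (simp add: abs_mult)
  moreover have "real n * (L2_inner ?\<chi> h - a / real n) = averaged n h x - a"
    using assms(2) avg by (simp add: right_diff_distrib)
  ultimately show ?thesis
    by simp
qed

lemma averaged_continuous_tendsto:
  assumes "continuous_on UNIV h" and "\<And>x. \<bar>h x\<bar> \<le> B"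
  shows "(\<lambda>n. L2norm (\<lambda>x. averaged n h x - h x)) \<longlonglongrightarrow> 0"
proof (rule LIMSEQ_imp_Suc, rule L2norm_bounded_convergence)
  have meas: "h \<in> borel_measurable unit_measure"
    using assms(1) continuous_imp_measurable_on_sets_lebesgue[of "{0..1}" h] continuous_on_subset[of UNIV h]
    by auto
  then have h: "h \<in> L2"
    using assms(2) by (rule L2_bounded)
  show "(\<lambda>x. averaged (Suc n) h x - h x) \<in> borel_measurable unit_measure" for n
    using L2_measurable[OF averaged_L2, of "Suc n" h] meas by simp
  show "\<bar>averaged (Suc n) h x - h x\<bar> \<le> B + B" if "x \<in> {0..1}" for n x
    using averaged_near[OF h _ that, of "Suc n" 0 B] assms(2) by (smt (verit) le_add1 plus_1_eq_Suc)
  show "AE x in unit_measure. (\<lambda>n. averaged (Suc n) h x - h x) \<longlonglongrightarrow> 0"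
  proof (rule AE_I2, rule LIMSEQ_Suc, rule tendstoI)
    fix x e :: real assume x: "x \<in> space unit_measure" and "0 < e"
    obtain d where "0 < d" and d: "\<And>y. dist y x < d \<Longrightarrow> dist (h y) (h x) < e / 2"
      using assms(1) \<open>0 < e\<close> unfolding continuous_on_iff by (metis UNIV_I half_gt_zero)
    have "\<forall>\<^sub>F n in sequentially. 1 / real n < d"
      using lim_1_over_n \<open>0 < d\<close> by (rule order_tendstoD)
    then show "\<forall>\<^sub>F n in sequentially. dist (averaged n h x - h x) 0 < e"
      using eventually_ge_at_top[of 1]
    proof eventually_elim
      case (elim n)
      have "\<bar>averaged n h x - h x\<bar> \<le> e / 2"
      proof (rule averaged_near[OF h \<open>1 \<le> n\<close>])
        show "\<bar>h y - h x\<bar> \<le> e / 2" if "\<bar>x - y\<bar> \<le> 1 / real n" for y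
          using d[of y] that elim by (simp add: dist_real_def abs_minus_commute)
      qed (use x in simp)
      then show ?case
        using \<open>0 < e\<close> by simp
    qed
  qed
qed

lemma L2_truncation_tendsto:
  assumes "f \<in> L2"
  shows "(\<lambda>n. L2norm (\<lambda>x. f x - max (- real n) (min (real n) (f x)))) \<longlonglongrightarrow> 0"
proof (rule L2norm_dominated_convergence[OF _ assms])
  show "(\<lambda>x. f x - max (- real n) (min (real n) (f x))) \<in> borel_measurable unit_measure" for n
    using L2_measurable[OF assms] by measurable
  show "\<bar>f x - max (- real n) (min (real n) (f x))\<bar> \<le> \<bar>f x\<bar>" for n x
    by (auto simp: max_def min_def)
  show "AE x in unit_measure. (\<lambda>n. f x - max (- real n) (min (real n) (f x))) \<longlonglongrightarrow> 0"
  proof (rule AE_I2, rule tendsto_eventually)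
    fix x
    show "\<forall>\<^sub>F n in sequentially. f x - max (- real n) (min (real n) (f x)) = 0"
      using eventually_ge_at_top[of "nat \<lceil>\<bar>f x\<bar>\<rceil>"]
    proof eventually_elim
      case (elim n)
      then have "\<bar>f x\<bar> \<le> real n"
        by linarith
      then show ?case
        by (auto simp: max_def min_def)
    qed
  qed
qed

text \<open>
  Density of the bounded continuous functions: \<open>f\<close> is approximated by a truncation, and the truncation
  by truncating continuous functions that converge to \<open>f\<close> almost everywhere.
\<close>
lemma L2_continuous_approximation:
  assumes "f \<in> L2" and "0 < e"
  obtains h B where "continuous_on UNIV h" and "\<And>x. \<bar>h x\<bar> \<le> B" and "h \<in> L2"
    and "L2norm (\<lambda>x. f x - h x) < e"
proof -
  define trunc where "trunc n a = max (- real n) (min (real n) a)" for n a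
  have trunc_bound: "\<bar>trunc n a\<bar> \<le> real n" for n a
    by (auto simp: trunc_def)
  have trunc_meas: "(\<lambda>x. trunc n (k x)) \<in> borel_measurable unit_measure"
    if "k \<in> borel_measurable unit_measure" for n k
    using that unfolding trunc_def by measurable
  have "\<forall>\<^sub>F n in sequentially. L2norm (\<lambda>x. f x - trunc n (f x)) < e / 2"
    using order_tendstoD(2)[OF L2_truncation_tendsto[OF assms(1)], of "e / 2"] \<open>0 < e\<close>
    unfolding trunc_def by simp
  then obtain N where N: "L2norm (\<lambda>x. f x - trunc N (f x)) < e / 2"
    by (auto simp: eventually_sequentially)
  have "f measurable_on {0..1}"
    using L2_measurable[OF assms(1)] by (simp add: measurable_on_iff_borel_measurable)
  then obtain Z k where Z: "negligible Z" and k: "\<And>m. continuous_on UNIV (k m)"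
    and lim: "\<And>x. x \<notin> Z \<Longrightarrow> (\<lambda>m. k m x) \<longlonglongrightarrow> (if x \<in> {0..1} then f x else 0)"
    unfolding measurable_on_def by blast
  define h where "h m x = trunc N (k m x)" for m x
  have h_cont: "continuous_on UNIV (h m)" for m
    unfolding h_def trunc_def by (intro continuous_intros k)
  have h_meas: "h m \<in> borel_measurable unit_measure" for m
    using continuous_imp_measurable_on_sets_lebesgue[of "{0..1}" "h m"] continuous_on_subset[OF h_cont]
    by auto
  have h_L2: "h m \<in> L2" for m
    using h_meas by (rule L2_bounded[where B = "real N"]) (simp add: h_def trunc_bound)
  have fN_L2: "(\<lambda>x. trunc N (f x)) \<in> L2"
    using trunc_meas[OF L2_measurable[OF assms(1)]] trunc_bound by (rule L2_bounded)
  have "(\<lambda>m. L2norm (\<lambda>x. trunc N (f x) - h m x)) \<longlonglongrightarrow> 0"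
  proof (rule L2norm_bounded_convergence)
    show "(\<lambda>x. trunc N (f x) - h m x) \<in> borel_measurable unit_measure" for m
      using h_meas L2_measurable[OF fN_L2] by simp
    show "\<bar>trunc N (f x) - h m x\<bar> \<le> real N + real N" for m x
      using trunc_bound[of N "f x"] trunc_bound[of N "k m x"] unfolding h_def by linarith
    have "AE x in lebesgue. x \<notin> Z"
      using Z by (intro AE_not_in) (simp add: negligible_iff_null_sets)
    then have "AE x in lebesgue. x \<in> {0..1} \<longrightarrow> (\<lambda>m. trunc N (f x) - h m x) \<longlonglongrightarrow> 0"
    proof eventually_elim
      case (elim x)
      show ?case
      proof
        assume "x \<in> {0..1}"
        then have "(\<lambda>m. k m x) \<longlonglongrightarrow> f x"
          using lim[OF elim] by simp
        then have "(\<lambda>m. trunc N (f x) - h m x) \<longlonglongrightarrow> trunc N (f x) - trunc N (f x)"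
          unfolding h_def trunc_def by (intro tendsto_intros)
        then show "(\<lambda>m. trunc N (f x) - h m x) \<longlonglongrightarrow> 0"
          by simp
      qed
    qed
    then show "AE x in unit_measure. (\<lambda>m. trunc N (f x) - h m x) \<longlonglongrightarrow> 0"
      by (simp add: AE_restrict_space_iff)
  qed
  then have "\<forall>\<^sub>F m in sequentially. L2norm (\<lambda>x. trunc N (f x) - h m x) < e / 2"
    using \<open>0 < e\<close> by (intro order_tendstoD(2)) auto
  then obtain m where m: "L2norm (\<lambda>x. trunc N (f x) - h m x) < e / 2"
    by (auto simp: eventually_sequentially)
  have "L2norm (\<lambda>x. f x - h m x) < e"
    using L2norm_triangle[OF L2_diff[OF assms(1) fN_L2] L2_diff[OF fN_L2 h_L2], of m] N m by simp
  then show thesis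
    using that[of "h m" "real N"] h_cont h_L2 trunc_bound by (simp add: h_def)
qed

text \<open>
  As averaging is a contraction, replacing \<open>g\<close> by a nearby continuous function \<open>h\<close> costs at
  most \<open>2 \<parallel>g - h\<parallel>\<close>.
\<close>
lemma averaged_tendsto:
  assumes "g \<in> L2"
  shows "(\<lambda>n. L2norm (\<lambda>x. averaged n g x - g x)) \<longlonglongrightarrow> 0"
proof (rule tendstoI)
  fix e :: real assume "0 < e"
  then obtain h B where h: "continuous_on UNIV h" "\<And>x. \<bar>h x\<bar> \<le> B" "h \<in> L2"
    and approx: "L2norm (\<lambda>x. g x - h x) < e / 3"
    using L2_continuous_approximation[OF assms, of "e / 3"] by auto
  have "\<forall>\<^sub>F n in sequentially. L2norm (\<lambda>x. averaged n h x - h x) < e / 3"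
    using order_tendstoD(2)[OF averaged_continuous_tendsto[OF h(1,2)], of "e / 3"] \<open>0 < e\<close> by simp
  then show "\<forall>\<^sub>F n in sequentially. dist (L2norm (\<lambda>x. averaged n g x - g x)) 0 < e"
  proof eventually_elim
    case (elim n)
    note d = L2_diff[OF assms h(3)]
    have "L2norm (\<lambda>x. averaged n (\<lambda>y. g y - h y) x - (g x - h x)) \<le> 2 * L2norm (\<lambda>x. g x - h x)"
      using L2norm_triangle_diff[OF averaged_L2[of n "\<lambda>y. g y - h y"] d] averaged_norm_le[OF d, of n] by simp
    moreover have "(\<lambda>x. averaged n g x - g x)
        = (\<lambda>x. (averaged n (\<lambda>y. g y - h y) x - (g x - h x)) + (averaged n h x - h x))"
      using assms h(3) by (simp add: averaged_diff)
    ultimately have "L2norm (\<lambda>x. averaged n g x - g x)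
        \<le> 2 * L2norm (\<lambda>x. g x - h x) + L2norm (\<lambda>x. averaged n h x - h x)"
      using L2norm_triangle[OF L2_diff[OF averaged_L2[of n "\<lambda>y. g y - h y"] d]
          L2_diff[OF averaged_L2[of n h] h(3)]] by simp
    then show ?case
      using approx elim by simp
  qed
qed

section \<open>The random walk on a graphon and on its samples\<close>

definition walk_kernel :: "(real \<times> real \<Rightarrow> real) \<Rightarrow> real \<times> real \<Rightarrow> real" where
  "walk_kernel W p = W p / graphon_degree W (snd p)"

lemma walk_generator_kernel_op: "walk_generator W f x = kernel_op (walk_kernel W) f x - f x"
  by (simp add: walk_generator_def kernel_op_def walk_kernel_def)

lemma classical_solution_kernel:
  assumes "classical_solution W g w"
  obtains w' where "L2_has_derivative w w'"
    and "\<forall>t\<ge>0. AE x in unit_measure. w' t x = kernel_op (walk_kernel W) (w t) x - w t x"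
    and "AE x in unit_measure. w 0 x = g x"
  using assms unfolding classical_solution_def walk_generator_kernel_op by blast

lemma sampled_walk_kernel_bounded:
  assumes "graphon W" and "1 \<le> n" and "0 < d"
    and "\<And>x. x \<in> {0..1} \<Longrightarrow> d \<le> graphon_degree (step_graphon n (sampled_graph W n)) x"
  shows "bounded_kernel (1 / d) (walk_kernel (step_graphon n (sampled_graph W n)))"
  unfolding bounded_kernel_def
proof (intro conjI ballI)
  show "walk_kernel (step_graphon n (sampled_graph W n))
      \<in> borel_measurable (unit_measure \<Otimes>\<^sub>M unit_measure)"
    unfolding walk_kernel_def[abs_def] by measurable
  fix x y :: real assume "x \<in> {0..1}" "y \<in> {0..1}"
  then show "\<bar>walk_kernel (step_graphon n (sampled_graph W n)) (x, y)\<bar> \<le> 1 / d"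
    using sampled_step_graphon_bounds[OF assms(1,2), of x y] assms(3) assms(4)[of y]
    by (simp add: walk_kernel_def frac_le)
qed

text \<open>
  The lower bound on the degree keeps the limits of the denominators away from \<open>0\<close>. It also makes every
  section of \<open>W\<close> integrable, since the integral of a function that is not integrable is \<open>0\<close>.
\<close>
lemma AE_sampled_walk_kernel_tendsto:
  assumes "graphon W" and "ae_continuous W" and "0 < c"
    and degree: "\<And>x. x \<in> {0..1} \<Longrightarrow> c \<le> graphon_degree W x"
  shows "AE x in unit_measure. AE y in unit_measure.
    (\<lambda>n. walk_kernel (step_graphon n (sampled_graph W n)) (x, y)) \<longlonglongrightarrow> walk_kernel W (x, y)"
proof -
  note conv = AE_sampled_step_graphon_tendsto[OF assms(2)]
  have degree_tendsto: "AE y in unit_measure.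
      (\<lambda>n. graphon_degree (step_graphon n (sampled_graph W n)) y) \<longlonglongrightarrow> graphon_degree W y"
    using conv AE_space
  proof eventually_elim
    case (elim y)
    then have y: "y \<in> {0..1}"
      by simp
    have "integrable unit_measure (\<lambda>z. W (y, z))"
    proof (rule ccontr)
      assume "\<not> integrable unit_measure (\<lambda>z. W (y, z))"
      then show False
        using degree[OF y] \<open>0 < c\<close> by (simp add: graphon_degree_def not_integrable_integral_eq)
    qed
    then show ?case
      using sampled_step_graphon_degree_tendsto[OF assms(1) y] elim by blast
  qed
  show ?thesis
    using conv
  proof eventually_elim
    case (elim x)
    show ?case
      using elim degree_tendsto AE_space
    proof eventually_elim
      case (elim y)
      then have "graphon_degree W y \<noteq> 0"
        using degree[of y] \<open>0 < c\<close> by auto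
      then show ?case
        using elim(1,2) unfolding walk_kernel_def by (simp add: tendsto_divide)
    qed
  qed
qed

theorem theorem5p6:
  fixes W :: "real \<times> real \<Rightarrow> real" and c :: real and g :: "real \<Rightarrow> real"
    and w :: "real \<Rightarrow> real \<Rightarrow> real" and u :: "nat \<Rightarrow> real \<Rightarrow> real \<Rightarrow> real"
  assumes "graphon W" and "connected_graphon W" and "ae_continuous W"
    and "0 < c" and "\<forall>x\<in>{0..1}. c \<le> graphon_degree W x"
    and "g \<in> L2"
    and "classical_solution W g w"
    and "\<exists>d>0. \<forall>\<^sub>F n in sequentially. \<forall>x\<in>{0..1}.
           d \<le> graphon_degree (step_graphon n (sampled_graph W n)) x"
    and "\<forall>\<^sub>F n in sequentially.
           classical_solution (step_graphon n (sampled_graph W n)) (averaged n g) (u n)"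
  shows "\<forall>t\<ge>0. (\<lambda>n. L2norm (\<lambda>x. u n t x - w t x)) \<longlonglongrightarrow> 0"
proof (intro allI impI)
  fix T :: real assume "0 \<le> T"
  define K where "K n = walk_kernel (step_graphon n (sampled_graph W n))" for n
  obtain d where "0 < d" and degree: "\<forall>\<^sub>F n in sequentially. \<forall>x\<in>{0..1}.
      d \<le> graphon_degree (step_graphon n (sampled_graph W n)) x"
    using assms(8) by blast
  have "\<forall>\<^sub>F n in sequentially. bounded_kernel (1 / d) (K n) \<and>
      classical_solution (step_graphon n (sampled_graph W n)) (averaged n g) (u n)"
    using degree assms(9) eventually_ge_at_top[of 1]
    by eventually_elim (auto simp: K_def intro!: sampled_walk_kernel_bounded[OF assms(1) _ \<open>0 < d\<close>])
  \<comment> \<open>Shifting by \<open>N\<close> leaves a sequence all of whose members satisfy the hypotheses.\<close>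
  then obtain N where "\<forall>n\<ge>N. bounded_kernel (1 / d) (K n) \<and>
      classical_solution (step_graphon n (sampled_graph W n)) (averaged n g) (u n)"
    unfolding eventually_sequentially by blast
  then have K: "\<And>n. bounded_kernel (1 / d) (K (n + N))"
    and sol: "\<And>n. classical_solution (step_graphon (n + N) (sampled_graph W (n + N)))
      (averaged (n + N) g) (u (n + N))"
    by simp_all
  have "AE x in unit_measure. AE y in unit_measure. (\<lambda>n. K n (x, y)) \<longlonglongrightarrow> walk_kernel W (x, y)"
    unfolding K_def using assms(5)
    by (intro AE_sampled_walk_kernel_tendsto[OF assms(1,3,4)]) auto
  then have "AE x in unit_measure. AE y in unit_measure.
      (\<lambda>n. K (n + N) (x, y)) \<longlonglongrightarrow> walk_kernel W (x, y)"
  proof eventually_elim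
    case (elim x)
    then show ?case
      by eventually_elim (rule LIMSEQ_ignore_initial_segment)
  qed
  with K obtain L where L: "bounded_kernel (1 / d) L"
    and L_eq: "AE x in unit_measure. AE y in unit_measure. L (x, y) = walk_kernel W (x, y)"
    and HS: "(\<lambda>n. HS_norm (\<lambda>p. K (n + N) p - L p)) \<longlonglongrightarrow> 0"
    by (rule HS_norm_limit)
  obtain w' where w: "L2_has_derivative w w'"
    and w': "\<forall>t\<ge>0. AE x in unit_measure. w' t x = kernel_op (walk_kernel W) (w t) x - w t x"
    and w0: "AE x in unit_measure. w 0 x = g x"
    using assms(7) by (rule classical_solution_kernel)
  have w_L2: "w t \<in> L2" if "0 \<le> t" for t
    using w that by (simp add: L2_has_derivative_def)
  \<comment> \<open>From here on the measurable kernel \<open>L\<close> stands in for the walk kernel of \<open>W\<close>.\<close>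
  have w'_L: "AE x in unit_measure. w' t x = kernel_op L (w t) x - w t x" if "0 \<le> t" for t
    using w'[rule_format, OF that] kernel_op_cong_AE[OF L w_L2[OF that] L_eq] by eventually_elim simp
  obtain R where R: "\<forall>t\<in>{0..T}. L2norm (w t) \<le> R"
    using w by (rule L2_curve_bounded)
  define bound where "bound n = exp ((2 * (1 / d) + 1) * T)
    * ((L2norm (\<lambda>x. averaged (n + N) g x - g x))\<^sup>2
       + (HS_norm (\<lambda>p. K (n + N) p - L p) * R)\<^sup>2 * T)" for n
  have estimate: "(L2norm (\<lambda>x. u (n + N) T x - w T x))\<^sup>2 \<le> bound n" for n
  proof -
    obtain u' where u: "L2_has_derivative (u (n + N)) u'"
      and u': "\<forall>t\<ge>0.
        AE x in unit_measure. u' t x = kernel_op (K (n + N)) (u (n + N) t) x - u (n + N) t x"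
      and u0: "AE x in unit_measure. u (n + N) 0 x = averaged (n + N) g x"
      using sol unfolding K_def by (rule classical_solution_kernel)
    have "u (n + N) 0 \<in> L2"
      using u by (simp add: L2_has_derivative_def)
    then have "L2norm (\<lambda>x. u (n + N) 0 x - w 0 x) = L2norm (\<lambda>x. averaged (n + N) g x - g x)"
      using w_L2[of 0] assms(6) averaged_L2
    proof (intro L2norm_cong_AE L2_diff)
      show "AE x in unit_measure. u (n + N) 0 x - w 0 x = averaged (n + N) g x - g x"
        using u0 w0 by eventually_elim simp
    qed auto
    then show ?thesis
      using kernel_flow_perturbation[OF K L u w u'[rule_format] w'_L \<open>0 \<le> T\<close> R] by (simp add: bound_def)
  qed
  have "(\<lambda>n. L2norm (\<lambda>x. averaged (n + N) g x - g x)) \<longlonglongrightarrow> 0"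
    using averaged_tendsto[OF assms(6)] by (rule LIMSEQ_ignore_initial_segment)
  then have "bound \<longlonglongrightarrow> exp ((2 * (1 / d) + 1) * T) * (0\<^sup>2 + (0 * R)\<^sup>2 * T)"
    unfolding bound_def by (intro tendsto_intros HS)
  then have "bound \<longlonglongrightarrow> 0"
    by simp
  then have "(\<lambda>n. sqrt (bound n)) \<longlonglongrightarrow> 0"
    using tendsto_real_sqrt by fastforce
  then have "(\<lambda>n. L2norm (\<lambda>x. u (n + N) T x - w T x)) \<longlonglongrightarrow> 0"
    by (rule Lim_null_comparison[rotated]) (simp add: real_le_rsqrt estimate)
  then show "(\<lambda>n. L2norm (\<lambda>x. u n T x - w T x)) \<longlonglongrightarrow> 0"
    by (rule LIMSEQ_offset)
qed

end
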